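(* Consider the partial differential equation $$\begin{aligned}\Bigg\{&\left[\Big(\tfrac{\partial}{\partial t}+\lambda\Big)^2-\lambda^2(1-p-q)^2\right]\left[\Big(\tfrac{\partial}{\partial t}+\lambda+\tfrac{\partial}{\partial s}\Big)^2-c^2\tfrac{\partial^2}{\partial y^2}\right]-4\lambda^2pq\Big(\tfrac{\partial}{\partial t}+\lambda\Big)\Big(\tfrac{\partial}{\partial t}+\lambda+\tfrac{\partial}{\partial s}\Big)\\&-4\lambda^3(1-p-q)(p^2+q^2)\Big(\tfrac{\partial}{\partial t}+\lambda+\tfrac12\tfrac{\partial}{\partial s}\Big)-\lambda^2(1-p-q)^2\Big(\tfrac{\partial}{\partial t}+\lambda\Big)^2-\lambda^4(p^2-q^2)^2\\&-4\lambda^4pq(1-p-q)^2+\lambda^4(1-p-q)^4\Bigg\}\bar u=0.\end{aligned}$$ For $\lambda,c\to+\infty$ with $\frac{\lambda}{c^2}\to1$, this partial differential equation becomes $$\frac{\partial \bar u}{\partial t}=-\frac12\frac{\partial \bar u}{\partial s}+\frac14\,\frac{(1-p)+(1-q)}{(1-p)^2+(1-q)^2}\,\frac{\partial^2\bar u}{\partial y^2}.$$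
   Context: The fourth-order equation is the one satisfied by the joint density $\bar u(s,y,t)$ of $(T(t),Y(t))$ in the interior of its support. Here $(X(t),Y(t))$ is the planar motion which starts at the origin, has speed $c$ and directions $d_j=(\cos(\pi j/2),\sin(\pi j/2))$, $j$ mod 4, with uniformly distributed initial direction, and which at the events of a rate-$\lambda$ homogeneous Poisson process changes direction from $d_j$ to $d_{j+1}$, $d_{j-1}$, $d_{j+2}$ with probabilities $p$, $q$, $1-p-q$ respectively; $T(t)$ is the time spent moving vertically (in directions $d_1,d_3$) up to time $t$.
   Formalization: The case p = q = 0 is excluded: there the particle only reverses, (T,Y) has no joint density, and u = s solves the fourth-order equation for all λ, c but not the limit equation. *)

theory Defs
  imports "HOL-Analysis.Analysis" "HOL-Library.Function_Algebras"
begin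

definition pderiv_dir :: "'a::euclidean_space \<Rightarrow> ('a \<Rightarrow> real) \<Rightarrow> 'a \<Rightarrow> real" where
  "pderiv_dir e f x = deriv (\<lambda>h. f (x + h *\<^sub>R e)) 0"

text \<open>\<^term>\<open>deriv\<close> is total, so existence of the partial derivatives is required explicitly.\<close>

primrec Ck_on :: "nat \<Rightarrow> 'a::euclidean_space set \<Rightarrow> ('a \<Rightarrow> real) \<Rightarrow> bool" where
  "Ck_on 0 U f \<longleftrightarrow> continuous_on U f"
| "Ck_on (Suc k) U f \<longleftrightarrow> continuous_on U f \<and>
     (\<forall>e\<in>Basis. (\<forall>x\<in>U. (\<lambda>h. f (x + h *\<^sub>R e)) differentiable (at 0)) \<and>
                Ck_on k U (pderiv_dir e f))"

text \<open>A point is a triple \<open>(s, y, t)\<close>: time spent moving vertically, vertical coordinate, time.\<close>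

type_synonym point = "real \<times> real \<times> real"
type_synonym oper = "(point \<Rightarrow> real) \<Rightarrow> (point \<Rightarrow> real)"

definition D_s :: oper where "D_s = pderiv_dir (1, 0, 0)"
definition D_y :: oper where "D_y = pderiv_dir (0, 1, 0)"
definition D_t :: oper where "D_t = pderiv_dir (0, 0, 1)"

definition scal :: "real \<Rightarrow> oper" where
  "scal a u = (\<lambda>x. a * u x)"

text \<open>In the algebra of operators, sums and differences are pointwise, products are compositions
  \<open>\<circ>\<close>, powers are iterates \<open>^^\<close>, and a number \<open>a\<close> is read as \<open>scal a\<close>.
  Below, \<open>r\<close> is the probability \<open>1 - p - q\<close> of a reversal of direction.\<close>

definition motion_oper :: "real \<Rightarrow> real \<Rightarrow> real \<Rightarrow> real \<Rightarrow> oper" where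
  "motion_oper lam c p q =
    (let r = 1 - p - q in
      (((D_t + scal lam) ^^ 2 - scal (lam\<^sup>2 * r\<^sup>2))
         \<circ> ((D_t + scal lam + D_s) ^^ 2 - (scal (c\<^sup>2) \<circ> D_y ^^ 2)))
      - (scal (4 * lam\<^sup>2 * p * q) \<circ> (D_t + scal lam) \<circ> (D_t + scal lam + D_s))
      - (scal (4 * lam ^ 3 * r * (p\<^sup>2 + q\<^sup>2)) \<circ> (D_t + scal lam + (scal (1/2) \<circ> D_s)))
      - (scal (lam\<^sup>2 * r\<^sup>2) \<circ> (D_t + scal lam) ^^ 2)
      - scal (lam ^ 4 * (p\<^sup>2 - q\<^sup>2)\<^sup>2)
      - scal (4 * lam ^ 4 * p * q * r\<^sup>2)
      + scal (lam ^ 4 * r ^ 4))"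

definition diffusivity :: "real \<Rightarrow> real \<Rightarrow> real" where
  "diffusivity p q = 1/4 * (((1 - p) + (1 - q)) / ((1 - p)\<^sup>2 + (1 - q)\<^sup>2))"

definition solves_motion_pde ::
    "real \<Rightarrow> real \<Rightarrow> real \<Rightarrow> real \<Rightarrow> point set \<Rightarrow> (point \<Rightarrow> real) \<Rightarrow> bool" where
  "solves_motion_pde lam c p q U u \<longleftrightarrow> (\<forall>x\<in>U. motion_oper lam c p q u x = 0)"

definition solves_limit_pde :: "real \<Rightarrow> real \<Rightarrow> point set \<Rightarrow> (point \<Rightarrow> real) \<Rightarrow> bool" where
  "solves_limit_pde p q U u \<longleftrightarrow>
     (\<forall>x\<in>U. D_t u x = - (1/2) * D_s u x + diffusivity p q * (D_y ^^ 2) u x)"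

text \<open>Convergence at a point of all iterated partial derivatives of order at most \<open>k\<close>;
  the list \<open>es\<close> gives the directions of differentiation.\<close>

definition derivs_tendsto ::
    "nat \<Rightarrow> ('i \<Rightarrow> 'a::euclidean_space \<Rightarrow> real) \<Rightarrow> ('a \<Rightarrow> real) \<Rightarrow> 'i filter \<Rightarrow> 'a \<Rightarrow> bool" where
  "derivs_tendsto k u v F x \<longleftrightarrow>
     (\<forall>es. set es \<subseteq> Basis \<and> length es \<le> k \<longrightarrow>
        ((\<lambda>i. foldr pderiv_dir es (u i) x) \<longlongrightarrow> foldr pderiv_dir es v x) F)"

end

theory Submission
  imports Defs
begin

text \<open>On \<open>C\<^sup>4\<close> functions the operator is a linear combination of iterated partial derivatives, with
  coefficients polynomial in \<open>\<lambda>\<close> and \<open>c\<^sup>2\<close>. The coefficient of \<open>\<lambda>\<^sup>4 u\<close> vanishes identically in \<open>p, q\<close>,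
  and the terms of size \<open>\<lambda>\<^sup>3\<close>, where \<open>c\<^sup>2\<close> counts as \<open>\<lambda>\<close>, form the limit equation times
  \<open>4 (p + q) ((1 - p)\<^sup>2 + (1 - q)\<^sup>2)\<close>. All other terms vanish after division by \<open>\<lambda>\<^sup>3\<close>,
  uniformly where the derivatives are bounded. The order of differentiation is recorded in each
  term, so symmetry of mixed partial derivatives plays no role.\<close>

section \<open>Formal sums of iterated partial derivatives\<close>

text \<open>Lists of weighted words, repetitions allowed, make operator arithmetic syntactic: sums
  append lists, scalars act on the weights, and a further derivative is consed onto every word as
  the outermost one.\<close>

definition dlin :: "(real \<times> 'a list) list \<Rightarrow> ('a::euclidean_space \<Rightarrow> real) \<Rightarrow> 'a \<Rightarrow> real" where
  "dlin cs u x = (\<Sum>(a, es)\<leftarrow>cs. a * foldr pderiv_dir es u x)"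

lemma dlin_simps [simp]:
  "dlin [] u x = 0"
  "dlin ((a, es) # cs) u x = a * foldr pderiv_dir es u x + dlin cs u x"
  "dlin (cs @ ds) u x = dlin cs u x + dlin ds u x"
  by (simp_all add: dlin_def)

lemma dlin_scale: "dlin (map (apfst ((*) b)) cs) u x = b * dlin cs u x"
  by (induction cs) (auto simp: algebra_simps)

definition words_le :: "nat \<Rightarrow> (real \<times> 'a::euclidean_space list) list \<Rightarrow> bool" where
  "words_le n cs \<longleftrightarrow> (\<forall>(a, es)\<in>set cs. set es \<subseteq> Basis \<and> length es \<le> n)"

lemma words_le_intros:
  "words_le n cs \<Longrightarrow> words_le n ds \<Longrightarrow> words_le n (cs @ ds)"
  "words_le n cs \<Longrightarrow> words_le n (map (apfst ((*) b)) cs)"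
  "words_le n cs \<Longrightarrow> e \<in> Basis \<Longrightarrow> words_le (Suc n) (map (apsnd (Cons e)) cs)"
  by (fastforce simp: words_le_def)+

lemma Ck_on_imp_continuous_on: "Ck_on k U f \<Longrightarrow> continuous_on U f"
  by (cases k) auto

lemma Ck_on_foldr_pderiv_dir:
  assumes "Ck_on k U u" "set es \<subseteq> Basis" "length es \<le> k"
  shows "Ck_on (k - length es) U (foldr pderiv_dir es u)"
  using assms(2,3)
proof (induction es)
  case Nil
  then show ?case using assms(1) by simp
next
  case (Cons e es)
  then have "Ck_on (Suc (k - length (e # es))) U (foldr pderiv_dir es u)"
    by (simp add: Suc_diff_Suc)
  with Cons.prems show ?case by simp
qed

lemma continuous_on_dlin:
  assumes "Ck_on k U u" "words_le k cs"
  shows "continuous_on U (dlin cs u)"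
  using assms(2)
proof (induction cs)
  case Nil
  then show ?case by (simp add: dlin_def)
next
  case (Cons ae cs)
  obtain a es where ae: "ae = (a, es)" by (cases ae)
  have "continuous_on U (foldr pderiv_dir es u)"
    using Cons.prems Ck_on_foldr_pderiv_dir[OF assms(1), of es]
    by (auto simp: words_le_def ae intro: Ck_on_imp_continuous_on)
  moreover have "continuous_on U (dlin cs u)"
    using Cons by (auto simp: words_le_def)
  ultimately show ?case
    by (simp add: ae dlin_simps(2)[abs_def] continuous_intros)
qed

text \<open>Because \<open>n < k\<close>, every word can be differentiated once more. This existence
  is what justifies linearity, since \<open>deriv\<close> takes a value even where no derivative
  exists.\<close>

lemma has_field_derivative_dlin:
  assumes "Ck_on k U u" "words_le n cs" "n < k" "e \<in> Basis" "x \<in> U"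
  shows "((\<lambda>h. dlin cs u (x + h *\<^sub>R e)) has_field_derivative
           dlin (map (apsnd (Cons e)) cs) u x) (at 0)"
  using assms(2)
proof (induction cs)
  case Nil
  then show ?case by simp
next
  case (Cons ae cs)
  obtain a es where ae: "ae = (a, es)" by (cases ae)
  have es: "set es \<subseteq> Basis" "length es < k"
    using Cons.prems assms(3) by (auto simp: words_le_def ae)
  then have "Ck_on (Suc (k - Suc (length es))) U (foldr pderiv_dir es u)"
    using Ck_on_foldr_pderiv_dir[OF assms(1), of es] by (simp add: Suc_diff_Suc)
  then have "(\<lambda>h. foldr pderiv_dir es u (x + h *\<^sub>R e)) differentiable (at 0)"
    using assms(4,5) by simp
  then have "((\<lambda>h. foldr pderiv_dir es u (x + h *\<^sub>R e)) has_field_derivative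
      pderiv_dir e (foldr pderiv_dir es u) x) (at 0)"
    unfolding pderiv_dir_def using DERIV_deriv_iff_real_differentiable by blast
  moreover have "((\<lambda>h. dlin cs u (x + h *\<^sub>R e)) has_field_derivative
      dlin (map (apsnd (Cons e)) cs) u x) (at 0)"
    using Cons by (auto simp: words_le_def)
  ultimately show ?case
    by (auto simp: ae intro!: DERIV_add DERIV_cmult)
qed

text \<open>As \<open>U\<close> is open, \<open>x + h *\<^sub>R e\<close> stays in \<open>U\<close>
  for small \<open>h\<close>, so the values of \<open>f\<close> on \<open>U\<close> determine its
  derivative at \<open>x\<close>.\<close>

lemma pderiv_dir_eq_dlin:
  assumes "open U" "Ck_on k U u" "words_le n cs" "n < k" "e \<in> Basis" "x \<in> U"
    and eq: "\<And>z. z \<in> U \<Longrightarrow> f z = dlin cs u z"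
  shows "pderiv_dir e f x = dlin (map (apsnd (Cons e)) cs) u x"
proof -
  have "((\<lambda>h. x + h *\<^sub>R e) \<longlongrightarrow> x + 0 *\<^sub>R e) (nhds (0::real))"
    by (intro tendsto_intros filterlim_ident)
  then have "\<forall>\<^sub>F h in nhds 0. x + h *\<^sub>R e \<in> U"
    using assms(1,6) by (auto dest: topological_tendstoD)
  then have "\<forall>\<^sub>F h in nhds 0. f (x + h *\<^sub>R e) = dlin cs u (x + h *\<^sub>R e)"
    by eventually_elim (rule eq)
  then have "pderiv_dir e f x = deriv (\<lambda>h. dlin cs u (x + h *\<^sub>R e)) 0"
    unfolding pderiv_dir_def by (rule deriv_cong_ev) simp
  also have "\<dots> = dlin (map (apsnd (Cons e)) cs) u x"
    using has_field_derivative_dlin[OF assms(2-6)] by (rule DERIV_imp_deriv)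
  finally show ?thesis .
qed

lemma derivs_tendsto_dlin:
  assumes "derivs_tendsto k u v F x" "words_le k cs"
  shows "((\<lambda>i. dlin cs (u i) x) \<longlongrightarrow> dlin cs v x) F"
  using assms(2)
proof (induction cs)
  case Nil
  then show ?case by simp
next
  case (Cons ae cs)
  obtain a es where ae: "ae = (a, es)" by (cases ae)
  have "((\<lambda>i. foldr pderiv_dir es (u i) x) \<longlongrightarrow> foldr pderiv_dir es v x) F"
    using Cons.prems assms(1) by (auto simp: words_le_def ae derivs_tendsto_def)
  moreover have "((\<lambda>i. dlin cs (u i) x) \<longlongrightarrow> dlin cs v x) F"
    using Cons by (auto simp: words_le_def)
  ultimately show ?case
    by (auto simp: ae intro!: tendsto_intros)
qed

section \<open>Closure of expansions under the operator operations\<close>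

definition represents ::
    "nat \<Rightarrow> 'a set \<Rightarrow> ('a::euclidean_space \<Rightarrow> real) \<Rightarrow> ('a \<Rightarrow> real) \<Rightarrow> (real \<times> 'a list) list \<Rightarrow> bool" where
  "represents n U u f cs \<longleftrightarrow> words_le n cs \<and> (\<forall>x\<in>U. f x = dlin cs u x)"

lemma represents_self: "represents n U u u [(1, [])]"
  by (simp add: represents_def words_le_def)

lemma represents_add:
  "represents n U u f cs \<Longrightarrow> represents n U u g ds \<Longrightarrow> represents n U u (f + g) (cs @ ds)"
  by (auto simp: represents_def words_le_intros)

lemma represents_scal:
  "represents n U u f cs \<Longrightarrow> represents n U u (scal a f) (map (apfst ((*) a)) cs)"
  by (auto simp: represents_def words_le_intros scal_def dlin_scale)

lemma represents_diff:
  "represents n U u f cs \<Longrightarrow> represents n U u g ds \<Longrightarrow>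
    represents n U u (f - g) (cs @ map (apfst ((*) (- 1))) ds)"
  by (auto simp: represents_def words_le_intros dlin_scale simp del: mult_minus1)

lemma represents_pderiv_dir:
  assumes "open U" "Ck_on k U u" "n < k" "e \<in> Basis" "represents n U u f cs"
  shows "represents (Suc n) U u (pderiv_dir e f) (map (apsnd (Cons e)) cs)"
  using assms pderiv_dir_eq_dlin[OF assms(1,2) _ assms(3,4)]
  by (auto simp: represents_def words_le_intros)

abbreviation (input) "e_s \<equiv> (1, 0, 0) :: point"
abbreviation (input) "e_y \<equiv> (0, 1, 0) :: point"
abbreviation (input) "e_t \<equiv> (0, 0, 1) :: point"

lemma e_in_Basis: "e_s \<in> Basis" "e_y \<in> Basis" "e_t \<in> Basis"
  by (auto simp: Basis_prod_def zero_prod_def)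

text \<open>The coefficients of \<open>\<lambda>\<^sup>2\<close>, \<open>\<lambda>\<close>, \<open>1\<close>, \<open>-2 \<lambda> c\<^sup>2\<close> and \<open>-c\<^sup>2\<close> in the operator.\<close>

definition rem1 :: "real \<Rightarrow> real \<Rightarrow> (real \<times> point list) list" where
  "rem1 p q = (let k = 1 - (1 - p - q)\<^sup>2 in
     [(2 * k + 4 - 4 * p * q, [e_t, e_t]), (k + 4 - 4 * p * q, [e_t, e_s]),
      (k, [e_s, e_t]), (k, [e_s, e_s])])"

definition rem2 :: "(real \<times> point list) list" where
  "rem2 = [(4, [e_t, e_t, e_t]), (4, [e_t, e_t, e_s]),
           (2, [e_t, e_s, e_t]), (2, [e_t, e_s, e_s])]"

definition rem3 :: "(real \<times> point list) list" where
  "rem3 = [(1, [e_t, e_t, e_t, e_t]), (1, [e_t, e_t, e_t, e_s]),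
           (1, [e_t, e_t, e_s, e_t]), (1, [e_t, e_t, e_s, e_s])]"

definition rem4 :: "(real \<times> point list) list" where
  "rem4 = [(1, [e_t, e_y, e_y])]"

definition rem5 :: "(real \<times> point list) list" where
  "rem5 = [(1, [e_t, e_t, e_y, e_y])]"

lemmas rem_defs = rem1_def rem2_def rem3_def rem4_def rem5_def

lemma words_le_rem:
  "words_le 4 (rem1 p q)" "words_le 4 rem2" "words_le 4 rem3" "words_le 4 rem4" "words_le 4 rem5"
  using e_in_Basis by (auto simp: words_le_def rem_defs Let_def)

text \<open>Transport part of the limit equation, which equates it with
  \<open>diffusivity p q\<close> times \<open>diffu\<close>. The weight 1/2 appears because the
  \<open>lam ^ 3\<close> coefficient of the s-derivative is half that of the t-derivative.\<close>

definition drift :: "(real \<times> point list) list" where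
  "drift = [(1, [e_t]), (1/2, [e_s])]"

definition diffu :: "(real \<times> point list) list" where
  "diffu = [(1, [e_y, e_y])]"

lemma words_le_main: "words_le 4 drift" "words_le 4 diffu"
  using e_in_Basis by (auto simp: words_le_def drift_def diffu_def)

text \<open>The cancellation rests on \<open>r = 1 - p - q\<close>. With \<open>m = p + q\<close>
  and \<open>d = p - q\<close>, the coefficient of \<open>lam ^ 4 * u x\<close> reduces to
  \<open>d\<^sup>2 * ((1 - r)\<^sup>2 - m\<^sup>2)\<close>, which is zero; the factor of
  \<open>diffu\<close> comes from \<open>1 - r\<^sup>2 = (1 - r) * (1 + r)\<close>.\<close>

lemma motion_oper_expansion:
  assumes "open U" "Ck_on 4 U u" "x \<in> U"
  shows "motion_oper lam c p q u x =
    4 * (p + q) * ((1 - p)\<^sup>2 + (1 - q)\<^sup>2) * lam ^ 3 * dlin drift u x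
    - (p + q) * (2 - p - q) * lam\<^sup>2 * c\<^sup>2 * dlin diffu u x
    + lam\<^sup>2 * dlin (rem1 p q) u x + lam * dlin rem2 u x + dlin rem3 u x
    - 2 * lam * c\<^sup>2 * dlin rem4 u x - c\<^sup>2 * dlin rem5 u x" (is "_ = ?R x")
proof -
  note step = represents_pderiv_dir[OF assms(1,2)]
  have sq: "(L ^^ 2) f = L (L f)" for L :: oper and f
    by (simp add: numeral_2_eq_2)
  have pm: "(L + M) f = L f + M f" "(L - M) f = L f - M f" for L M :: oper and f
    by (simp_all add: plus_fun_def fun_diff_def)
  have lt: "0 < (4::nat)" "Suc 0 < 4" "Suc (Suc 0) < 4" "Suc (Suc (Suc 0)) < 4"
    by simp_all
  \<comment> \<open>Order 4 is spelled with successors because each derivative rule peels off one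
    \<open>Suc\<close>. As the order is only an upper bound, terms of lower order fit as
    well.\<close>
  have "\<exists>cs. represents (Suc (Suc (Suc (Suc 0)))) U u (motion_oper lam c p q u) cs
          \<and> (\<forall>x. dlin cs u x = ?R x)"
    unfolding motion_oper_def Let_def
    apply (simp only: pm o_apply sq)
    apply (unfold D_t_def D_s_def D_y_def)
    \<comment> \<open>The list stays schematic here; the closure rules build it along the structure
      of the operator.\<close>
    apply (rule exI, rule conjI)
     apply (rule represents_add represents_diff represents_scal step represents_self e_in_Basis lt)+
    apply (simp add: drift_def diffu_def rem_defs Let_def)
    apply (rule allI)
    \<comment> \<open>A polynomial identity in \<open>lam\<close>, \<open>c\<close>,
      \<open>p\<close>, \<open>q\<close>, with the iterated derivatives as atoms.\<close>
    by algebra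
  then show ?thesis
    using assms(3) unfolding represents_def by metis
qed

section \<open>Normalisation and passage to the limit\<close>

text \<open>A continuous function is bounded on a compact set, so convergence of the coefficient,
  which is independent of \<open>x\<close>, becomes uniform.\<close>

lemma uniform_limit_scaled:
  fixes f :: "'a::topological_space \<Rightarrow> real"
  assumes "(a \<longlongrightarrow> l) F" "compact K" "continuous_on K f"
  shows "uniform_limit K (\<lambda>i x. a i * f x) (\<lambda>x. l * f x) F"
proof (rule uniform_lim_mult)
  show "uniform_limit K (\<lambda>i x. a i) (\<lambda>x. l) F"
    using assms(1) by (auto simp: uniform_limit_iff tendsto_iff elim: eventually_mono)
  show "bounded (f ` K)"
    using assms(2,3) by (intro compact_imp_bounded compact_continuous_image)
  show "bounded ((\<lambda>x. l) ` K)"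
    by (rule bounded_subset[of "{l}"]) auto
qed (rule uniform_limit_const)

abbreviation (input) "norm_const p q \<equiv> 4 * (p + q) * ((1 - p)\<^sup>2 + (1 - q)\<^sup>2)"

lemma norm_const_nonzero:
  fixes p q :: real
  assumes "0 < p + q" "p + q \<le> 1"
  shows "norm_const p q \<noteq> 0"
proof -
  \<comment> \<open>Otherwise \<open>p = q = 1\<close>, contradicting
    \<open>p + q \<le> 1\<close>.\<close>
  have "1 - p \<noteq> 0 \<or> 1 - q \<noteq> 0" using assms by auto
  then show ?thesis using assms by (auto simp: sum_power2_eq_zero_iff)
qed

text \<open>Identifies the diffusivity as the ratio of the two leading coefficients, of
  \<open>diffu\<close> and of \<open>drift\<close>.\<close>

lemma diffusivity_eq:
  assumes "0 < p + q" "p + q \<le> 1"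
  shows "(p + q) * (2 - p - q) = diffusivity p q * norm_const p q"
proof -
  have "m * k = 1/4 * (k / S) * (4 * m * S)" if "S \<noteq> 0" for m k S :: real
    using that by simp
  moreover have "(1 - p) + (1 - q) = 2 - p - q"
    by simp
  ultimately show ?thesis
    using norm_const_nonzero[OF assms] unfolding diffusivity_def by (metis mult_zero_right)
qed

text \<open>The normalised operator in the variables \<open>e = 1 / lam\<close> and
  \<open>g = c\<^sup>2 / lam\<close>. It is polynomial in them, so its limit is its value at
  \<open>e = 0\<close>, \<open>g = 1\<close>.\<close>

definition scaled_motion :: "real \<Rightarrow> real \<Rightarrow> real \<Rightarrow> real \<Rightarrow> (point \<Rightarrow> real) \<Rightarrow> point \<Rightarrow> real" where
  "scaled_motion p q e g u x =
     dlin drift u x - (diffusivity p q * g) * dlin diffu u x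
     + (e / norm_const p q) * dlin (rem1 p q) u x + (e\<^sup>2 / norm_const p q) * dlin rem2 u x
     + (e ^ 3 / norm_const p q) * dlin rem3 u x - (2 * e * g / norm_const p q) * dlin rem4 u x
     - (e\<^sup>2 * g / norm_const p q) * dlin rem5 u x"

lemma motion_oper_eq_scaled_motion:
  assumes "open U" "Ck_on 4 U u" "x \<in> U" "0 < p + q" "p + q \<le> 1" "lam > 0"
  shows "motion_oper lam c p q u x / (norm_const p q * lam ^ 3)
           = scaled_motion p q (1 / lam) (c\<^sup>2 / lam) u x"
proof -
  \<comment> \<open>The derivatives are replaced by arbitrary reals, leaving a pure field
    identity.\<close>
  have main: "(N * lam ^ 3 * A - (kap * N) * lam\<^sup>2 * c\<^sup>2 * B + lam\<^sup>2 * C + lam * D + E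
      - 2 * lam * c\<^sup>2 * G - c\<^sup>2 * H) / (N * lam ^ 3)
     = A - (kap * (c\<^sup>2 / lam)) * B + ((1 / lam) / N) * C + ((1 / lam)\<^sup>2 / N) * D
       + ((1 / lam) ^ 3 / N) * E - (2 * (1 / lam) * (c\<^sup>2 / lam) / N) * G
       - ((1 / lam)\<^sup>2 * (c\<^sup>2 / lam) / N) * H"
    if "N \<noteq> 0" for N A B C D E G H kap :: real
    using that assms(6) by (simp add: field_simps power2_eq_square power3_eq_cube)
  show ?thesis
    unfolding motion_oper_expansion[OF assms(1-3)] scaled_motion_def diffusivity_eq[OF assms(4,5)]
    by (rule main[OF norm_const_nonzero[OF assms(4,5)]])
qed

theorem theorem10:
  fixes p q :: real and lam c :: "'i \<Rightarrow> real" and F :: "'i filter"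
  assumes "0 \<le> p" and "0 \<le> q" and "p + q \<le> 1" and "0 < p + q"
    and "F \<noteq> bot"
    and "filterlim lam at_top F" and "filterlim c at_top F"
    and "((\<lambda>i. lam i / (c i)\<^sup>2) \<longlongrightarrow> 1) F"
  shows "(\<forall>U u K. open U \<and> Ck_on 4 U u \<and> compact K \<and> K \<subseteq> U \<longrightarrow>
            uniform_limit K
              (\<lambda>i x. motion_oper (lam i) (c i) p q u x
                       / (4 * (p + q) * ((1 - p)\<^sup>2 + (1 - q)\<^sup>2) * lam i ^ 3))
              (\<lambda>x. D_t u x - (- (1/2) * D_s u x + diffusivity p q * (D_y ^^ 2) u x)) F)
       \<and> (\<forall>U V u v. open U \<and> Ck_on 4 U v
            \<and> (\<forall>i. open (V i) \<and> Ck_on 4 (V i) (u i)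
                  \<and> solves_motion_pde (lam i) (c i) p q (V i) (u i))
            \<and> (\<forall>x\<in>U. eventually (\<lambda>i. x \<in> V i) F \<and> derivs_tendsto 4 u v F x)
            \<longrightarrow> solves_limit_pde p q U v)"
proof (intro conjI allI impI)
  define e g where "e i = 1 / lam i" and "g i = (c i)\<^sup>2 / lam i" for i
  have pq: "0 < p + q" "p + q \<le> 1" by fact+
  have lam_pos: "\<forall>\<^sub>F i in F. lam i > 0"
    using assms(6) by (rule filterlim_at_top_dense[THEN iffD1, rule_format])
  have e: "(e \<longlongrightarrow> 0) F"
    unfolding e_def using assms(6) by (intro tendsto_divide_0[OF tendsto_const] filterlim_at_top_imp_at_infinity)
  \<comment> \<open>\<open>g\<close> is the inverse of the ratio assumed to tend to 1.\<close>
  have g: "(g \<longlongrightarrow> 1) F"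
    using tendsto_inverse[OF assms(8)] by (simp add: g_def[abs_def])
  have coefs: "((\<lambda>i. diffusivity p q * g i) \<longlongrightarrow> diffusivity p q) F"
    "((\<lambda>i. e i / norm_const p q) \<longlongrightarrow> 0) F"
    "((\<lambda>i. (e i)\<^sup>2 / norm_const p q) \<longlongrightarrow> 0) F"
    "((\<lambda>i. e i ^ 3 / norm_const p q) \<longlongrightarrow> 0) F"
    "((\<lambda>i. 2 * e i * g i / norm_const p q) \<longlongrightarrow> 0) F"
    "((\<lambda>i. (e i)\<^sup>2 * g i / norm_const p q) \<longlongrightarrow> 0) F"
    using norm_const_nonzero[OF pq] by (auto intro!: tendsto_eq_intros e g)
  have limit: "dlin drift u x - diffusivity p q * dlin diffu u x
      = D_t u x - (- (1/2) * D_s u x + diffusivity p q * (D_y ^^ 2) u x)" for u x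
    by (simp add: drift_def diffu_def D_t_def D_s_def D_y_def numeral_2_eq_2)
  {
    fix U :: "point set" and u K
    assume *: "open U \<and> Ck_on 4 U u \<and> compact K \<and> K \<subseteq> U"
    have cont: "continuous_on K (dlin cs u)" if "words_le 4 cs" for cs
      using * that continuous_on_dlin continuous_on_subset by blast
    note scaled = uniform_limit_scaled[OF _ _ cont]
    \<comment> \<open>Every remainder coefficient carries a factor \<open>e i\<close> and tends to
      0. The zero terms are kept in the limit so that the limit rules apply term by term.\<close>
    have "uniform_limit K (\<lambda>i. scaled_motion p q (e i) (g i) u)
        (\<lambda>x. dlin drift u x - diffusivity p q * dlin diffu u x
           + 0 * dlin (rem1 p q) u x + 0 * dlin rem2 u x + 0 * dlin rem3 u x
           - 0 * dlin rem4 u x - 0 * dlin rem5 u x) F"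
      unfolding scaled_motion_def using *
      by (intro uniform_limit_add uniform_limit_minus uniform_limit_const scaled coefs
          words_le_rem words_le_main) auto
    moreover have "\<forall>\<^sub>F i in F. \<forall>x\<in>K. scaled_motion p q (e i) (g i) u x
        = motion_oper (lam i) (c i) p q u x / (norm_const p q * lam i ^ 3)"
      using lam_pos
    proof eventually_elim
      case (elim i)
      then show ?case
        using * motion_oper_eq_scaled_motion[OF _ _ _ pq] by (auto simp: e_def g_def)
    qed
    ultimately show "uniform_limit K
        (\<lambda>i x. motion_oper (lam i) (c i) p q u x / (norm_const p q * lam i ^ 3))
        (\<lambda>x. D_t u x - (- (1/2) * D_s u x + diffusivity p q * (D_y ^^ 2) u x)) F"
      by (subst (asm) uniform_limit_cong) (auto simp: limit)
  }
  {
    fix U V and u :: "'i \<Rightarrow> point \<Rightarrow> real" and v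
    assume *: "open U \<and> Ck_on 4 U v
      \<and> (\<forall>i. open (V i) \<and> Ck_on 4 (V i) (u i) \<and> solves_motion_pde (lam i) (c i) p q (V i) (u i))
      \<and> (\<forall>x\<in>U. eventually (\<lambda>i. x \<in> V i) F \<and> derivs_tendsto 4 u v F x)"
    show "solves_limit_pde p q U v"
      unfolding solves_limit_pde_def
    proof
      fix x assume x: "x \<in> U"
      \<comment> \<open>Convergence of all derivatives up to order 4 at the fixed point
        \<open>x\<close> lets the functions \<open>u i\<close> vary together with the
        coefficients.\<close>
      have tend: "((\<lambda>i. dlin cs (u i) x) \<longlongrightarrow> dlin cs v x) F" if "words_le 4 cs" for cs
        using * x that derivs_tendsto_dlin by blast
      have "((\<lambda>i. scaled_motion p q (e i) (g i) (u i) x) \<longlongrightarrow>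
          dlin drift v x - diffusivity p q * dlin diffu v x
           + 0 * dlin (rem1 p q) v x + 0 * dlin rem2 v x + 0 * dlin rem3 v x
           - 0 * dlin rem4 v x - 0 * dlin rem5 v x) F"
        unfolding scaled_motion_def
        by (intro tendsto_add tendsto_diff tendsto_mult tend coefs words_le_rem words_le_main)
      moreover have "\<forall>\<^sub>F i in F. x \<in> V i"
        using * x by blast
      then have "\<forall>\<^sub>F i in F. scaled_motion p q (e i) (g i) (u i) x = 0"
        using lam_pos
      proof eventually_elim
        case (elim i)
        then have "motion_oper (lam i) (c i) p q (u i) x = 0"
          using * by (auto simp: solves_motion_pde_def)
        then show ?case
          using * elim motion_oper_eq_scaled_motion[OF _ _ _ pq, of "V i" "u i" x "lam i" "c i"]
          by (simp add: e_def g_def)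
      qed
      then have "((\<lambda>i. scaled_motion p q (e i) (g i) (u i) x) \<longlongrightarrow> 0) F"
        by (rule tendsto_eventually)
      \<comment> \<open>The scaled operator is eventually 0 at \<open>x\<close>; since
        \<open>F \<noteq> bot\<close>, its limit is unique and hence 0.\<close>
      ultimately have "dlin drift v x - diffusivity p q * dlin diffu v x = 0"
        using tendsto_unique[OF assms(5)] by fastforce
      then show "D_t v x = - (1/2) * D_s v x + diffusivity p q * (D_y ^^ 2) v x"
        unfolding limit by simp
    qed
  }
qed

end
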